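(* Let $n\ge 2$ and let $K_n$ be the complete graph on $n$ vertices. For every nonzero eigenvalue $\mu=\frac{n-k}{n-1}$ of the $1$-Laplacian of $K_n$ (where $k$ is an integer with $1\le k\le\lfloor n/2\rfloor$), $$\nu(\mu,K_n)=2.$$
   Context: For a finite simple connected graph $G=(V,E)$, $V=\{1,\dots,n\}$, with degrees $d_i$: $\mathrm{Sgn}(t)=\{1\}$ if $t>0$, $\{-1\}$ if $t<0$, $[-1,1]$ if $t=0$. A nonzero $\vec x\in\mathbb R^n$ is an eigenvector of the $1$-Laplacian with eigenvalue $\mu$ if there exist $z_{ij}\in\mathrm{Sgn}(x_i-x_j)$ with $z_{ji}=-z_{ij}$ (for all adjacent $i,j$) such that $\sum_{j\sim i}z_{ij}\in\mu d_i\,\mathrm{Sgn}(x_i)$ for all $i\in V$. The (strong) nodal domains of $\vec x$ are the vertex sets of the connected components of the subgraphs induced on $\{i:x_i>0\}$ and on $\{i:x_i<0\}$; $S(\vec x)$ is the total number of them. For an eigenvalue $\mu$ of $G$, $\nu(\mu,G)$ is the maximum of $S(\vec\phi)$ over all eigenvectors $\vec\phi$ of $G$ with eigenvalue $\mu$. *)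

theory Defs
  imports Complex_Main "Graph_Theory.Graph_Theory"
begin

text \<open>
  A finite simple undirected graph is a symmetric digraph without loops and parallel arcs
  (locale \<^locale>\<open>graph\<close>): each edge is a pair of opposite arcs, so \<^const>\<open>out_degree\<close> is the usual
  degree and strongly connected components are the usual connected components.
  A vector indexed by the vertices is a function whose values outside \<^term>\<open>verts G\<close> are irrelevant.
\<close>

definition Sgn :: "real \<Rightarrow> real set" where
  "Sgn t = (if t > 0 then {1} else if t < 0 then {-1} else {-1..1})"

definition one_laplacian_eigenvector :: "('a, 'b) pre_digraph \<Rightarrow> real \<Rightarrow> ('a \<Rightarrow> real) \<Rightarrow> bool" where
  "one_laplacian_eigenvector G \<mu> x \<longleftrightarrow>
     (\<exists>i\<in>verts G. x i \<noteq> 0) \<and>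
     (\<exists>z :: 'a \<Rightarrow> 'a \<Rightarrow> real.
        (\<forall>i j. i \<rightarrow>\<^bsub>G\<^esub> j \<longrightarrow> z i j \<in> Sgn (x i - x j) \<and> z j i = - z i j) \<and>
        (\<forall>i\<in>verts G. (\<Sum>j | i \<rightarrow>\<^bsub>G\<^esub> j. z i j) \<in> (\<lambda>s. \<mu> * real (out_degree G i) * s) ` Sgn (x i)))"

definition one_laplacian_eigenvalue :: "('a, 'b) pre_digraph \<Rightarrow> real \<Rightarrow> bool" where
  "one_laplacian_eigenvalue G \<mu> \<longleftrightarrow> (\<exists>x. one_laplacian_eigenvector G \<mu> x)"

definition nodal_domains :: "('a, 'b) pre_digraph \<Rightarrow> ('a \<Rightarrow> real) \<Rightarrow> 'a set set" where
  "nodal_domains G x =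
     verts ` pre_digraph.sccs (G \<restriction> {i \<in> verts G. x i > 0}) \<union>
     verts ` pre_digraph.sccs (G \<restriction> {i \<in> verts G. x i < 0})"

definition nodal_count :: "('a, 'b) pre_digraph \<Rightarrow> ('a \<Rightarrow> real) \<Rightarrow> nat" where
  "nodal_count G x = card (nodal_domains G x)"

text \<open>
  For finite \<open>G\<close> the counts are bounded by \<^term>\<open>card (verts G)\<close>, so the set below is finite;
  it is nonempty exactly when \<open>\<mu>\<close> is an eigenvalue.
\<close>

definition max_nodal_count :: "real \<Rightarrow> ('a, 'b) pre_digraph \<Rightarrow> nat" where
  "max_nodal_count \<mu> G = Max {nodal_count G x | x. one_laplacian_eigenvector G \<mu> x}"

end

theory Submission
  imports Defs
begin

text \<open>
  The vertices of one sign induce a complete subgraph, so they form at most one nodal domain, and a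
  vector has at most two. For two disjoint \<open>k\<close>-sets \<open>A\<close>, \<open>B\<close> the vector \<open>1\<^sub>A - 1\<^sub>B\<close> is an eigenvector
  for \<open>(n - k) / (n - 1)\<close> with \<open>z\<^sub>i\<^sub>j = sgn (x\<^sub>i - x\<^sub>j)\<close>, and it attains the bound.
\<close>

text \<open>Without parallel arcs \<open>head G\<close> is injective on the arcs leaving
  \<open>i\<close>. This ties the degree, which counts arcs, to the sums over neighbours in the
  eigenvector condition.\<close>

lemma (in nomulti_digraph) out_degree_eq_card_dominates:
  "out_degree G i = card {j. i \<rightarrow>\<^bsub>G\<^esub> j}"
proof -
  have "bij_betw (head G) (out_arcs G i) {j. i \<rightarrow>\<^bsub>G\<^esub> j}"
    by (rule bij_betwI')
      (auto simp: arcs_ends_conv arc_to_ends_def intro: no_multi_arcs)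
  then show ?thesis
    unfolding out_degree_def by (rule bij_betw_same_card)
qed

text \<open>\<open>strongly_connected\<close> demands a nonempty vertex set, so a sign that does not
  occur contributes no nodal domain.\<close>

lemma sccs_empty: "verts G = {} \<Longrightarrow> pre_digraph.sccs G = {}"
  unfolding pre_digraph.sccs_def strongly_connected_def induced_subgraph_def subgraph_def
  by auto

lemma (in wf_digraph) sccs_clique:
  assumes "verts G \<noteq> {}"
    and clique: "\<And>u v. u \<in> verts G \<Longrightarrow> v \<in> verts G \<Longrightarrow> u \<noteq> v \<Longrightarrow> u \<rightarrow>\<^bsub>G\<^esub> v"
  shows "sccs = {G}"
proof -
  have "u \<rightarrow>\<^sup>*\<^bsub>G\<^esub> v" if "u \<in> verts G" "v \<in> verts G" for u v
    using that clique by (cases "u = v") auto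
  then show ?thesis
    using assms(1) strongly_connected_eq_iff by blast
qed

lemma verts_sccs_induce_complete:
  assumes "complete_digraph n G" and "S \<subseteq> verts G"
  shows "verts ` pre_digraph.sccs (G \<restriction> S) = (if S = {} then {} else {S})"
proof (cases "S = {}")
  case True
  then show ?thesis by (simp add: sccs_empty)
next
  case False
  interpret graph G using assms(1) by (simp add: complete_digraph_def)
  interpret S: wf_digraph "G \<restriction> S" by (rule wellformed_induce_subgraph)
  have "u \<rightarrow>\<^bsub>G \<restriction> S\<^esub> v" if "u \<in> S" "v \<in> S" "u \<noteq> v" for u v
  proof -
    have "u \<rightarrow>\<^bsub>G\<^esub> v"
      using that assms by (auto simp: complete_digraph_def)
    with that show ?thesis by (force simp: arcs_ends_conv)
  qed
  then have "S.sccs = {G \<restriction> S}"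
    using False by (intro S.sccs_clique) auto
  then show ?thesis using False by simp
qed

text \<open>Each sign class is a clique and hence a single domain; removing \<open>{{}}\<close>
  discards a sign that does not occur.\<close>

lemma nodal_domains_complete:
  assumes "complete_digraph n G"
  shows "nodal_domains G x = {{i \<in> verts G. x i > 0}, {i \<in> verts G. x i < 0}} - {{}}"
  unfolding nodal_domains_def
  by (subst (1 2) verts_sccs_induce_complete[OF assms]) auto

lemma nodal_count_complete_le_2:
  assumes "complete_digraph n G"
  shows "nodal_count G x \<le> 2"
proof -
  let ?P = "{i \<in> verts G. x i > 0}" and ?N = "{i \<in> verts G. x i < 0}"
  have "card ({?P, ?N} - {{}}) \<le> card {?P, ?N}"
    by (rule card_mono) auto
  also have "\<dots> \<le> 2"
    using card_insert_le_m1[of 2 "{?N}" ?P] by simp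
  finally show ?thesis
    unfolding nodal_count_def nodal_domains_complete[OF assms] .
qed

lemma nodal_count_complete_eq_2:
  assumes "complete_digraph n G" and "i \<in> verts G" "x i > 0" and "j \<in> verts G" "x j < 0"
  shows "nodal_count G x = 2"
proof -
  let ?P = "{i \<in> verts G. x i > 0}" and ?N = "{i \<in> verts G. x i < 0}"
  have "i \<in> ?P" "i \<notin> ?N" "j \<in> ?N" using assms by auto
  then have "?P \<noteq> {}" "?N \<noteq> {}" "?P \<noteq> ?N" by blast+
  then have "{?P, ?N} - {{}} = {?P, ?N}" "card {?P, ?N} = 2" by auto
  then show ?thesis
    unfolding nodal_count_def nodal_domains_complete[OF assms(1)] by simp
qed

text \<open>A vertex of \<open>A\<close> has a larger value than exactly the \<open>n - k\<close>
  vertices outside \<open>A\<close>, and \<open>B\<close> is symmetric. At any other vertex the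
  contributions of \<open>A\<close> and \<open>B\<close> cancel because both sets have size
  \<open>k\<close>. Dividing by the degree \<open>n - 1\<close> gives the eigenvalue.\<close>

lemma complete_eigenvector:
  fixes G :: "('a, 'b) pre_digraph" and x :: "'a \<Rightarrow> real"
  assumes G: "complete_digraph n G" and "n \<ge> 2"
    and AB: "A \<subseteq> verts G" "B \<subseteq> verts G" "A \<inter> B = {}" "card A = k" "card B = k" "k \<ge> 1"
  defines "x \<equiv> \<lambda>i. of_bool (i \<in> A) - of_bool (i \<in> B)"
  shows "one_laplacian_eigenvector G ((real n - real k) / (real n - 1)) x"
proof -
  interpret graph G using G by (simp add: complete_digraph_def)
  have card_V: "card (verts G) = n"
    and adj: "\<And>i j. i \<rightarrow>\<^bsub>G\<^esub> j \<longleftrightarrow> i \<in> verts G \<and> j \<in> verts G \<and> i \<noteq> j"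
    using G by (auto simp: complete_digraph_def)
  have sum_A: "(\<Sum>j\<in>verts G. of_bool (j \<in> A)) = real k"
    and sum_B: "(\<Sum>j\<in>verts G. of_bool (j \<in> B)) = real k"
    using AB by (auto simp: Int_absorb1 Int_def[symmetric])
  have sum_sgn: "(\<Sum>j | i \<rightarrow>\<^bsub>G\<^esub> j. sgn (x i - x j)) = (real n - real k) * x i"
    if "i \<in> verts G" for i
  proof -
    \<comment> \<open>The added term \<open>j = i\<close> is \<open>sgn 0 = 0\<close>.\<close>
    have "(\<Sum>j | i \<rightarrow>\<^bsub>G\<^esub> j. sgn (x i - x j)) = (\<Sum>j\<in>verts G. sgn (x i - x j))"
      using that by (intro sum.mono_neutral_left) (auto simp: adj)
    also have "\<dots> = (real n - real k) * x i"
    proof -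
      consider "i \<in> A" "i \<notin> B" | "i \<in> B" "i \<notin> A" | "i \<notin> A" "i \<notin> B"
        using AB by blast
      then show ?thesis
      proof cases
        case 1
        then have "sgn (x i - x j) = 1 - of_bool (j \<in> A)" for j
          using AB by (auto simp: x_def)
        with 1 show ?thesis
          by (simp only: sum_subtractf sum_A) (simp add: x_def card_V)
      next
        case 2
        then have "sgn (x i - x j) = of_bool (j \<in> B) - 1" for j
          using AB by (auto simp: x_def)
        with 2 show ?thesis
          by (simp only: sum_subtractf sum_B) (simp add: x_def card_V)
      next
        case 3
        then have "sgn (x i - x j) = of_bool (j \<in> B) - of_bool (j \<in> A)" for j
          using AB by (auto simp: x_def)
        with 3 show ?thesis
          by (simp only: sum_subtractf sum_A sum_B) (simp add: x_def)
      qed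
    qed
    finally show ?thesis .
  qed
  have degree: "real (out_degree G i) = real n - 1" if "i \<in> verts G" for i
  proof -
    have "{j. i \<rightarrow>\<^bsub>G\<^esub> j} = verts G - {i}" using that by (auto simp: adj)
    then show ?thesis
      using that \<open>n \<ge> 2\<close> by (simp add: out_degree_eq_card_dominates card_V of_nat_diff)
  qed
  \<comment> \<open>The values of \<open>x\<close> are only -1, 0 and 1, so \<open>x i\<close>
    itself serves as the element \<open>s\<close> of \<open>Sgn (x i)\<close>; the factor
    \<open>n - 1\<close> then cancels since \<open>n \<ge> 2\<close>.\<close>
  have "x i \<in> Sgn (x i)" for i
    by (simp add: x_def Sgn_def)
  then have "(\<Sum>j | i \<rightarrow>\<^bsub>G\<^esub> j. sgn (x i - x j))
      \<in> (\<lambda>s. (real n - real k) / (real n - 1) * real (out_degree G i) * s) ` Sgn (x i)"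
    if "i \<in> verts G" for i
    using that \<open>n \<ge> 2\<close> by (intro image_eqI[of _ _ "x i"]) (simp_all add: sum_sgn degree)
  \<comment> \<open>At ties \<open>sgn\<close> selects 0 from the interval [-1,1]; antisymmetry
    holds because \<open>sgn\<close> is odd.\<close>
  moreover have "sgn (x i - x j) \<in> Sgn (x i - x j)" "sgn (x j - x i) = - sgn (x i - x j)" for i j
    by (auto simp: Sgn_def sgn_if)
  moreover have "\<exists>i\<in>verts G. x i \<noteq> 0"
  proof -
    obtain a where "a \<in> A" using AB by fastforce
    then show ?thesis using AB by (intro bexI[of _ a]) (auto simp: x_def)
  qed
  ultimately show ?thesis
    unfolding one_laplacian_eigenvector_def
    by (intro conjI exI[of _ "\<lambda>i j. sgn (x i - x j)"]) blast+
qed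

lemma obtain_disjoint_subsets_card:
  assumes "2 * k \<le> card V"
  obtains A B where "A \<subseteq> V" "B \<subseteq> V" "A \<inter> B = {}" "card A = k" "card B = k"
proof -
  \<comment> \<open>Splitting a set of size \<open>2 * k\<close> into a \<open>k\<close>-subset and
    its complement yields the disjoint pair.\<close>
  obtain C where C: "C \<subseteq> V" "card C = 2 * k"
    using obtain_subset_with_card_n[OF assms] by blast
  then obtain A where A: "A \<subseteq> C" "card A = k" "finite A"
    using obtain_subset_with_card_n[of k C] by auto
  show thesis
    by (rule that[of A "C - A"]) (use A C in \<open>auto simp: card_Diff_subset\<close>)
qed

theorem theorem5:
  fixes n k :: nat and \<mu> :: real and G :: "('a, 'b) pre_digraph"
  assumes "n \<ge> 2"
    and "complete_digraph n G"
    and "one_laplacian_eigenvalue G \<mu>" and "\<mu> \<noteq> 0"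
    and "1 \<le> k" and "k \<le> n div 2"
    and "\<mu> = (real n - real k) / (real n - 1)"
  shows "max_nodal_count \<mu> G = 2"
proof -
  have "2 * k \<le> card (verts G)"
    using assms(2,6) by (simp add: complete_digraph_def)
  then obtain A B where AB: "A \<subseteq> verts G" "B \<subseteq> verts G" "A \<inter> B = {}" "card A = k" "card B = k"
    by (rule obtain_disjoint_subsets_card)
  define x :: "'a \<Rightarrow> real" where "x = (\<lambda>i. of_bool (i \<in> A) - of_bool (i \<in> B))"
  have eig: "one_laplacian_eigenvector G \<mu> x"
    unfolding x_def assms(7) using assms(1,2,5) AB by (intro complete_eigenvector)
  \<comment> \<open>Since \<open>k \<ge> 1\<close>, both sets are nonempty, so both signs occur in
    \<open>x\<close>.\<close>
  obtain a b where "a \<in> A" "b \<in> B" using AB assms(5) by fastforce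
  then have "nodal_count G x = 2"
    using AB by (intro nodal_count_complete_eq_2[OF assms(2), of a _ b]) (auto simp: x_def)
  with eig have "2 \<in> {nodal_count G x | x. one_laplacian_eigenvector G \<mu> x}"
    by (metis (mono_tags, lifting) mem_Collect_eq)
  \<comment> \<open>The bound also makes the set of counts finite, as \<open>Max\<close>
    requires.\<close>
  moreover have "{nodal_count G x | x. one_laplacian_eigenvector G \<mu> x} \<subseteq> {..2}"
    using nodal_count_complete_le_2[OF assms(2)] by auto
  ultimately show ?thesis
    unfolding max_nodal_count_def by (intro Max_eqI) (auto intro: finite_subset)
qed

end
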